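(* Let $a<b$ and let $p,s,q,\omega\in C([a,b])$ be real-valued with $p>0$ and $\omega>0$ on $[a,b]$. Let $\lambda_1,\lambda_2,\lambda_3,\ldots$ be the eigenvalues, listed in increasing order, of the boundary value problem $$-\left(p(x)(y'(x)+s(x)y(x))\right)'+s(x)p(x)(y'(x)+s(x)y(x))+q(x)y(x)=\lambda\,\omega(x)y(x),\qquad y(a)=y(b)=0 .$$ Put $\bar s(x)=\int_a^x s(t)\,\mathrm{d}t$, $\tilde p(x)=p(x)e^{-2\bar s(x)}$ and $\tilde\omega(x)=\omega(x)e^{-2\bar s(x)}$. Suppose $h\in C([a,b])$ satisfies $h(x)\ge\tilde p(x)$ for all $x\in[a,b]$, and define $$D:=\min_{x\in[a,b]}\tilde\omega(x)h(x)>0,\qquad M:=\max_{x\in[a,b]}\frac{q(x)}{\omega(x)} .$$ Then $$\lambda_n\ \le\ \frac{n^2\pi^2}{D\left(\displaystyle\int_a^b\frac{1}{h(x)}\,\mathrm{d}x\right)^2}+M,\qquad n=1,2,3,\ldots$$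
   Context: A solution of the differential equation is a differentiable function $y$ on $[a,b]$ such that the quasi-derivative $p(y'+sy)$ is also differentiable on $[a,b]$ and the equation holds at every point. A number $\lambda$ is an eigenvalue if the boundary value problem has a solution $y$ that is not identically zero. The eigenvalues are numbered from $n=1$ in increasing order. *)

theory Defs
  imports "HOL-Analysis.Analysis"
begin

text \<open>
  All derivatives are taken within \<open>{a..b}\<close>, so they are one-sided at the endpoints.
  The function \<open>y'\<close> is determined by \<open>y\<close> on \<open>{a..b}\<close> because \<open>a < b\<close>.
\<close>

definition SL_solution ::
  "real \<Rightarrow> real \<Rightarrow> (real \<Rightarrow> real) \<Rightarrow> (real \<Rightarrow> real) \<Rightarrow> (real \<Rightarrow> real) \<Rightarrow> (real \<Rightarrow> real) \<Rightarrow>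
   real \<Rightarrow> (real \<Rightarrow> real) \<Rightarrow> bool"
where
  "SL_solution a b p s q \<omega> \<mu> y \<longleftrightarrow>
    (\<exists>y' z'. \<forall>x\<in>{a..b}.
      (y has_real_derivative y' x) (at x within {a..b}) \<and>
      ((\<lambda>t. p t * (y' t + s t * y t)) has_real_derivative z' x) (at x within {a..b}) \<and>
      - z' x + s x * p x * (y' x + s x * y x) + q x * y x = \<mu> * \<omega> x * y x)"

definition SL_eigenvalue ::
  "real \<Rightarrow> real \<Rightarrow> (real \<Rightarrow> real) \<Rightarrow> (real \<Rightarrow> real) \<Rightarrow> (real \<Rightarrow> real) \<Rightarrow> (real \<Rightarrow> real) \<Rightarrow>
   real \<Rightarrow> bool"
where
  "SL_eigenvalue a b p s q \<omega> \<mu> \<longleftrightarrow>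
    (\<exists>y. SL_solution a b p s q \<omega> \<mu> y \<and> y a = 0 \<and> y b = 0 \<and> (\<exists>x\<in>{a..b}. y x \<noteq> 0))"

text \<open>
  The listing starts at index \<open>1\<close>; the value at \<open>0\<close> is irrelevant.
\<close>

definition SL_eigenvalue_listing ::
  "real \<Rightarrow> real \<Rightarrow> (real \<Rightarrow> real) \<Rightarrow> (real \<Rightarrow> real) \<Rightarrow> (real \<Rightarrow> real) \<Rightarrow> (real \<Rightarrow> real) \<Rightarrow>
   (nat \<Rightarrow> real) \<Rightarrow> bool"
where
  "SL_eigenvalue_listing a b p s q \<omega> ev \<longleftrightarrow>
    strict_mono_on {1..} ev \<and> ev ` {1..} = {\<mu>. SL_eigenvalue a b p s q \<omega> \<mu>}"

definition s_bar :: "real \<Rightarrow> (real \<Rightarrow> real) \<Rightarrow> real \<Rightarrow> real" where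
  "s_bar a s x = integral {a..x} s"

text \<open>
  \<open>exp_weight a s f\<close> is the function written with a tilde over \<open>f\<close>,
  for \<open>f = p\<close> and \<open>f = \<omega>\<close>.
\<close>

definition exp_weight :: "real \<Rightarrow> (real \<Rightarrow> real) \<Rightarrow> (real \<Rightarrow> real) \<Rightarrow> real \<Rightarrow> real" where
  "exp_weight a s f x = f x * exp (- 2 * s_bar a s x)"

end

theory Submission
  imports Defs
begin

text \<open>
  Substituting \<open>u = y exp (s_bar)\<close> and \<open>v = p (y' + s y) exp (- s_bar)\<close> removes \<open>s\<close> from the
  equation: it becomes \<open>u' = v / P\<close>, \<open>v' = - (\<lambda> W - Q) u\<close>, where \<open>P\<close>, \<open>W\<close>, \<open>Q\<close> are
  \<open>p\<close>, \<open>\<omega>\<close>, \<open>q\<close> multiplied by \<open>exp (- 2 s_bar)\<close>. In the scaled polar coordinates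
  \<open>u = r sin \<theta>\<close>, \<open>v = k r cos \<theta>\<close> with a constant \<open>k > 0\<close>, the angle satisfies the scalar equation
  \<open>\<theta>' = (k / P) cos\<^sup>2 \<theta> + ((\<lambda> W - Q) / k) sin\<^sup>2 \<theta>\<close>, \<open>\<theta> a = 0\<close>,
  and \<open>\<lambda>\<close> is an eigenvalue as soon as \<open>\<theta> b\<close> is a positive multiple of \<open>\<pi>\<close>
  (\<open>eigenvalue_if_pruefer_angle_multiple_of_pi\<close>).

  Let \<open>H\<close> be the integral of \<open>1 / h\<close> and take \<open>k = n \<pi> / H\<close>, so that the claimed bound is
  \<open>\<Lambda> = k\<^sup>2 / D + M\<close>. For \<open>\<lambda> = \<Lambda>\<close> both coefficients of the angle equation are at
  least \<open>k / h\<close>: the first because \<open>P \<le> h\<close>, and the second because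
  \<open>\<Lambda> W - Q = W (\<Lambda> - q / \<omega>) \<ge> W (\<Lambda> - M) = W k\<^sup>2 / D \<ge> k\<^sup>2 / h\<close>. As
  \<open>cos\<^sup>2 + sin\<^sup>2 = 1\<close>, this gives \<open>\<theta>' \<ge> k / h\<close>, hence \<open>\<theta> b \<ge> k H = n \<pi>\<close>. The scale \<open>k\<close>
  is chosen to make the two lower bounds equal, so that the angle can be estimated by integration. If on the other hand
  \<open>\<lambda>\<close> lies below all values of \<open>q / \<omega>\<close>, then \<open>\<theta>' < 0\<close> wherever \<open>\<theta> = \<pi> / 2\<close>, so the angle never
  reaches \<open>\<pi> / 2\<close> (\<open>below_barrier\<close>). Since \<open>\<theta> b\<close> depends continuously on \<open>\<lambda>\<close>, it takes each
  of the values \<open>\<pi>, 2 \<pi>, \<dots>, n \<pi>\<close> for some \<open>\<lambda> \<le> \<Lambda>\<close>. These are \<open>n\<close> different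
  eigenvalues up to \<open>\<Lambda>\<close>, so the \<open>n\<close>-th eigenvalue is at most \<open>\<Lambda>\<close>.

  The right-hand side of the angle equation is globally Lipschitz in \<open>\<theta>\<close>, so solutions exist on
  all of \<open>[a, b]\<close> by Picard iteration (\<open>volterra_solution_exists\<close>), and continuity in
  \<open>\<lambda>\<close> follows from a Gronwall-type estimate (\<open>volterra_growth_bound\<close>). The amplitude \<open>r\<close> is then
  an explicit exponential of an integral (\<open>pruefer_amplitude\<close>).
\<close>

section \<open>Volterra integral equations with a Lipschitz right-hand side\<close>

text \<open>
  Integration gains the factor \<open>1 / (2 L)\<close> against the weight \<open>exp (2 L (t - a))\<close>. The operator that
  integrates an \<open>L\<close>-Lipschitz right-hand side therefore is a contraction with factor \<open>1 / 2\<close> in the weighted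
  supremum norm, on an interval of any length.
\<close>

lemma integral_exp_weight_bound:
  fixes g :: "real \<Rightarrow> real"
  assumes "a \<le> x" "L > 0" "c \<ge> 0" "continuous_on {a..x} g"
    and bound: "\<And>t. t \<in> {a..x} \<Longrightarrow> \<bar>g t\<bar> \<le> c * exp (2 * L * (t - a))"
  shows "\<bar>integral {a..x} g\<bar> \<le> c / (2 * L) * exp (2 * L * (x - a))"
proof -
  let ?E = "\<lambda>t. c / (2 * L) * exp (2 * L * (t - a))"
  have E: "((\<lambda>t. c * exp (2 * L * (t - a))) has_integral ?E x - ?E a) {a..x}"
  proof (rule fundamental_theorem_of_calculus[OF \<open>a \<le> x\<close>])
    fix t assume "t \<in> {a..x}"
    show "(?E has_vector_derivative c * exp (2 * L * (t - a))) (at t within {a..x})"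
      using \<open>L > 0\<close>
      by (auto intro!: derivative_eq_intros simp flip: has_real_derivative_iff_has_vector_derivative)
  qed
  have "norm (integral {a..x} g) \<le> integral {a..x} (\<lambda>t. c * exp (2 * L * (t - a)))"
    using bound assms(4) E
    by (intro Henstock_Kurzweil_Integration.integral_norm_bound_integral)
       (auto intro: integrable_continuous_real)
  also have "\<dots> = ?E x - ?E a"
    using E by (rule integral_unique)
  also have "\<dots> \<le> ?E x"
    using assms by simp
  finally show ?thesis by simp
qed

text \<open>
  A form of Gronwall's inequality. Its proof compares the weighted supremum of \<open>d\<close> with itself: at the
  point where it is attained, the contraction property bounds it by half of itself plus a
  multiple of \<open>\<epsilon>\<close>.
\<close>

lemma volterra_growth_bound:
  fixes d g :: "real \<Rightarrow> real"
  assumes "a \<le> b" "L > 0" "\<epsilon> \<ge> 0" "continuous_on {a..b} d" "continuous_on {a..b} g"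
    and d: "\<And>x. x \<in> {a..b} \<Longrightarrow> d x = integral {a..x} g"
    and g: "\<And>t. t \<in> {a..b} \<Longrightarrow> \<bar>g t\<bar> \<le> L * \<bar>d t\<bar> + \<epsilon>"
    and "x \<in> {a..b}"
  shows "\<bar>d x\<bar> \<le> \<epsilon> / L * exp (2 * L * (x - a))"
proof -
  let ?E = "\<lambda>t. exp (2 * L * (t - a))"
  have "continuous_on {a..b} (\<lambda>t. \<bar>d t\<bar> / ?E t)"
    using assms(4) by (auto intro!: continuous_intros)
  then obtain x0 where x0: "x0 \<in> {a..b}"
    and max: "\<And>t. t \<in> {a..b} \<Longrightarrow> \<bar>d t\<bar> / ?E t \<le> \<bar>d x0\<bar> / ?E x0"
    using continuous_attains_sup[of "{a..b}"] \<open>a \<le> b\<close> by force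
  define N where "N = \<bar>d x0\<bar> / ?E x0"
  have dN: "\<bar>d t\<bar> \<le> N * ?E t" if "t \<in> {a..b}" for t
    using max[OF that] unfolding N_def by (simp add: pos_divide_le_eq)
  have "N \<ge> 0" by (simp add: N_def)
  have "\<bar>g t\<bar> \<le> (L * N + \<epsilon>) * ?E t" if t: "t \<in> {a..x0}" for t
  proof -
    have tab: "t \<in> {a..b}" using t x0 by auto
    have "\<bar>g t\<bar> \<le> L * (N * ?E t) + \<epsilon> * 1"
      using g[OF tab] mult_left_mono[OF dN[OF tab], of L] \<open>L > 0\<close> by linarith
    also have "\<dots> \<le> L * (N * ?E t) + \<epsilon> * ?E t"
      using t \<open>L > 0\<close> \<open>\<epsilon> \<ge> 0\<close> by (intro add_left_mono mult_left_mono) auto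
    finally show ?thesis by (simp add: algebra_simps)
  qed
  then have "\<bar>integral {a..x0} g\<bar> \<le> (L * N + \<epsilon>) / (2 * L) * ?E x0"
    using x0 assms \<open>N \<ge> 0\<close> by (intro integral_exp_weight_bound) (auto elim: continuous_on_subset)
  then have "N \<le> (L * N + \<epsilon>) / (2 * L)"
    using d[OF x0] by (simp add: N_def pos_divide_le_eq)
  then have "N \<le> \<epsilon> / L"
    using \<open>L > 0\<close> by (simp add: field_simps)
  then have "N * ?E x \<le> \<epsilon> / L * ?E x"
    by (intro mult_right_mono) auto
  then show ?thesis
    using dN[OF \<open>x \<in> {a..b}\<close>] by linarith
qed

text \<open>
  Picard iteration from the zero function. By the contraction property the increments decay like
  \<open>(1 / 2) ^ n\<close> uniformly on the interval, so the iterates converge uniformly to a fixed point.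
\<close>

lemma volterra_solution_exists:
  fixes f :: "real \<Rightarrow> real \<Rightarrow> real"
  assumes "a \<le> b" "L > 0"
    and f: "\<And>\<phi>. continuous_on {a..b} \<phi> \<Longrightarrow> continuous_on {a..b} (\<lambda>t. f t (\<phi> t))"
    and lip: "\<And>t y z. t \<in> {a..b} \<Longrightarrow> \<bar>f t y - f t z\<bar> \<le> L * \<bar>y - z\<bar>"
  obtains \<theta> where "continuous_on {a..b} \<theta>"
    and "\<And>x. x \<in> {a..b} \<Longrightarrow> \<theta> x = integral {a..x} (\<lambda>t. f t (\<theta> t))"
proof -
  let ?E = "\<lambda>t. exp (2 * L * (t - a))"
  define T where "T \<phi> = (\<lambda>x. integral {a..x} (\<lambda>t. f t (\<phi> t)))" for \<phi>
  define X where "X n = (T ^^ n) (\<lambda>_. 0)" for n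
  have X0: "X 0 = (\<lambda>_. 0)" and XSuc: "X (Suc n) = T (X n)" for n
    by (simp_all add: X_def)
  have T: "continuous_on {a..b} (T \<phi>)" if "continuous_on {a..b} \<phi>" for \<phi>
    unfolding T_def
    by (rule indefinite_integral_continuous_1) (intro integrable_continuous_real f that)
  have X: "continuous_on {a..b} (X n)" for n
    by (induction n) (simp_all add: X0 XSuc T)
  have T_diff: "T \<phi> x - T \<psi> x = integral {a..x} (\<lambda>t. f t (\<phi> t) - f t (\<psi> t))"
    if "continuous_on {a..b} \<phi>" "continuous_on {a..b} \<psi>" "x \<in> {a..b}" for \<phi> \<psi> x
    unfolding T_def using that
    by (intro integral_diff[symmetric] integrable_continuous_real continuous_on_subset[OF f]) auto
  have T_contr: "\<bar>T \<phi> x - T \<psi> x\<bar> \<le> c / 2 * ?E x"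
    if \<phi>: "continuous_on {a..b} \<phi>" and \<psi>: "continuous_on {a..b} \<psi>" and x: "x \<in> {a..b}"
      and "c \<ge> 0" and c: "\<And>t. t \<in> {a..b} \<Longrightarrow> \<bar>\<phi> t - \<psi> t\<bar> \<le> c * ?E t" for \<phi> \<psi> x c
  proof -
    have "\<bar>integral {a..x} (\<lambda>t. f t (\<phi> t) - f t (\<psi> t))\<bar> \<le> (L * c) / (2 * L) * ?E x"
    proof (rule integral_exp_weight_bound)
      show "continuous_on {a..x} (\<lambda>t. f t (\<phi> t) - f t (\<psi> t))"
        using x by (intro continuous_on_diff continuous_on_subset[OF f] \<phi> \<psi>) auto
      fix t assume "t \<in> {a..x}"
      then have t: "t \<in> {a..b}" using x by auto
      have "\<bar>f t (\<phi> t) - f t (\<psi> t)\<bar> \<le> L * (c * ?E t)"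
        using lip[OF t, of "\<phi> t" "\<psi> t"] mult_left_mono[OF c[OF t], of L] \<open>L > 0\<close> by linarith
      then show "\<bar>f t (\<phi> t) - f t (\<psi> t)\<bar> \<le> L * c * ?E t" by (simp add: mult.assoc)
    qed (use x \<open>L > 0\<close> \<open>c \<ge> 0\<close> in auto)
    then show ?thesis
      using T_diff[OF \<phi> \<psi> x] \<open>L > 0\<close> by simp
  qed
  have "bounded ((X 1) ` {a..b})"
    by (intro compact_imp_bounded compact_continuous_image X) auto
  then obtain C where C: "C > 0" "\<And>x. x \<in> {a..b} \<Longrightarrow> \<bar>X 1 x\<bar> \<le> C"
    by (auto simp: bounded_pos)
  have step: "\<forall>x\<in>{a..b}. \<bar>X (Suc n) x - X n x\<bar> \<le> C / 2 ^ n * ?E x" for n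
  proof (induction n)
    case 0
    have "C * 1 \<le> C * ?E x" if "x \<in> {a..b}" for x
      using that C(1) \<open>L > 0\<close> by (intro mult_left_mono) auto
    then show ?case using C(2) by (force simp: X0)
  next
    case (Suc n)
    then show ?case
      using T_contr[OF X[of "Suc n"] X[of n], of _ "C / 2 ^ n"] C(1)
      by (auto simp: XSuc[of "Suc n"] XSuc[of n, symmetric] mult.commute)
  qed
  have "uniform_limit {a..b} (\<lambda>n x. \<Sum>i<n. X (Suc i) x - X i x)
      (\<lambda>x. \<Sum>i. X (Suc i) x - X i x) sequentially"
  proof (rule Weierstrass_m_test)
    fix n x assume x: "x \<in> {a..b}"
    have "C / 2 ^ n * ?E x \<le> C / 2 ^ n * ?E b"
      using x C(1) \<open>L > 0\<close> by (intro mult_left_mono) auto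
    then show "norm (X (Suc n) x - X n x) \<le> C * ?E b * (1 / 2) ^ n"
      using step[of n] x by (force simp: power_one_over field_simps)
  qed (intro summable_mult summable_geometric, simp)
  moreover have "(\<lambda>n x. \<Sum>i<n. X (Suc i) x - X i x) = X"
    using sum_lessThan_telescope[of "\<lambda>i. X i x" n for x n] by (simp add: X0 fun_eq_iff)
  ultimately obtain \<theta> where lim: "uniform_limit {a..b} X \<theta> sequentially"
    by metis
  have \<theta>: "continuous_on {a..b} \<theta>"
    by (rule uniform_limit_theorem[OF _ lim]) (auto simp: X)
  have "\<theta> x = T \<theta> x" if x: "x \<in> {a..b}" for x
  proof (rule LIMSEQ_unique)
    show "(\<lambda>n. X (Suc n) x) \<longlonglongrightarrow> \<theta> x"
      using tendsto_uniform_limitI[OF lim x] by (rule LIMSEQ_Suc)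
    show "(\<lambda>n. X (Suc n) x) \<longlonglongrightarrow> T \<theta> x"
    proof (rule LIMSEQ_I)
      fix r :: real assume "r > 0"
      define e where "e = r / ?E x"
      have "e > 0" using \<open>r > 0\<close> by (simp add: e_def)
      then obtain n0 where n0: "\<And>n t. n \<ge> n0 \<Longrightarrow> t \<in> {a..b} \<Longrightarrow> \<bar>X n t - \<theta> t\<bar> < e"
        using uniform_limitD[OF lim] by (force simp: eventually_sequentially dist_real_def)
      have "\<bar>X (Suc n) x - T \<theta> x\<bar> < r" if n: "n \<ge> n0" for n
      proof -
        have "\<bar>X n t - \<theta> t\<bar> \<le> e * ?E t" if "t \<in> {a..b}" for t
        proof -
          have "e * 1 \<le> e * ?E t"
            using that \<open>e > 0\<close> \<open>L > 0\<close> by (intro mult_left_mono) auto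
          then show ?thesis using n0[OF n that] by simp
        qed
        then have "\<bar>X (Suc n) x - T \<theta> x\<bar> \<le> e / 2 * ?E x"
          using T_contr[OF X \<theta> x, of e n] \<open>e > 0\<close> by (simp add: XSuc)
        also have "\<dots> < r" using \<open>r > 0\<close> by (simp add: e_def)
        finally show ?thesis .
      qed
      then show "\<exists>no. \<forall>n\<ge>no. norm (X (Suc n) x - T \<theta> x) < r" by auto
    qed
  qed
  with \<theta> show ?thesis by (intro that) (auto simp: T_def)
qed

section \<open>The Pruefer angle\<close>

lemma abs_sin_squared_diff_le: "\<bar>(sin y)\<^sup>2 - (sin z)\<^sup>2\<bar> \<le> \<bar>y - z\<bar>" for y z :: real
proof -
  have "(sin y)\<^sup>2 - (sin z)\<^sup>2 = sin (y + z) * sin (y - z)"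
    using sin_cos_squared_add[of y] sin_cos_squared_add[of z]
    unfolding sin_add sin_diff by algebra
  also have "\<bar>\<dots>\<bar> \<le> 1 * \<bar>y - z\<bar>"
    unfolding abs_mult by (intro mult_mono abs_sin_x_le_abs_x) auto
  finally show ?thesis by simp
qed

lemma pruefer_rhs_lipschitz:
  fixes A B y z :: real
  shows "\<bar>(A * (cos y)\<^sup>2 + B * (sin y)\<^sup>2) - (A * (cos z)\<^sup>2 + B * (sin z)\<^sup>2)\<bar>
    \<le> (\<bar>A\<bar> + \<bar>B\<bar>) * \<bar>y - z\<bar>"
proof -
  have "(A * (cos y)\<^sup>2 + B * (sin y)\<^sup>2) - (A * (cos z)\<^sup>2 + B * (sin z)\<^sup>2)
      = (B - A) * ((sin y)\<^sup>2 - (sin z)\<^sup>2)"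
    by (simp add: cos_squared_eq algebra_simps)
  also have "\<bar>\<dots>\<bar> \<le> (\<bar>A\<bar> + \<bar>B\<bar>) * \<bar>y - z\<bar>"
    unfolding abs_mult by (intro mult_mono abs_sin_squared_diff_le) auto
  finally show ?thesis .
qed

text \<open>
  The coefficient of \<open>sin\<^sup>2\<close> is unbounded in the parameter \<open>l\<close>. Restricting \<open>l\<close> to a compact interval
  provides one Lipschitz constant for all parameters, which makes the value at \<open>b\<close> Lipschitz in \<open>l\<close>.
\<close>

lemma pruefer_angle_family:
  fixes A W Q :: "real \<Rightarrow> real" and c d :: real
  assumes "a \<le> b"
    and A: "continuous_on {a..b} A" and W: "continuous_on {a..b} W" and Q: "continuous_on {a..b} Q"
  obtains \<theta> where "\<And>l. l \<in> {c..d} \<Longrightarrow> \<theta> l a = 0"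
    and "\<And>l x. l \<in> {c..d} \<Longrightarrow> x \<in> {a..b} \<Longrightarrow> (\<theta> l has_real_derivative
           A x * (cos (\<theta> l x))\<^sup>2 + (l * W x - Q x) * (sin (\<theta> l x))\<^sup>2) (at x within {a..b})"
    and "continuous_on {c..d} (\<lambda>l. \<theta> l b)"
proof -
  define f where "f l t y = A t * (cos y)\<^sup>2 + (l * W t - Q t) * (sin y)\<^sup>2" for l t y
  have bnd: "\<exists>C>0. \<forall>x\<in>{a..b}. \<bar>g x\<bar> \<le> C" if "continuous_on {a..b} g" for g :: "real \<Rightarrow> real"
    using compact_imp_bounded[OF compact_continuous_image[OF that]] by (auto simp: bounded_pos)
  obtain CA CW CQ where CA: "CA > 0" "\<And>x. x \<in> {a..b} \<Longrightarrow> \<bar>A x\<bar> \<le> CA"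
    and CW: "CW > 0" "\<And>x. x \<in> {a..b} \<Longrightarrow> \<bar>W x\<bar> \<le> CW"
    and CQ: "CQ > 0" "\<And>x. x \<in> {a..b} \<Longrightarrow> \<bar>Q x\<bar> \<le> CQ"
    using bnd[OF A] bnd[OF W] bnd[OF Q] by blast
  define L where "L = CA + ((\<bar>c\<bar> + \<bar>d\<bar>) * CW + CQ)"
  have "(\<bar>c\<bar> + \<bar>d\<bar>) * CW \<ge> 0" using CW by simp
  then have "L > 0" using CA CQ unfolding L_def by linarith
  have f_cont: "continuous_on {a..b} (\<lambda>t. f l t (\<phi> t))" if "continuous_on {a..b} \<phi>" for l \<phi>
    unfolding f_def using that A W Q by (intro continuous_intros)
  have f_lip: "\<bar>f l t y - f l t z\<bar> \<le> L * \<bar>y - z\<bar>" if l: "l \<in> {c..d}" and t: "t \<in> {a..b}" for l t y z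
  proof -
    have "\<bar>l * W t - Q t\<bar> \<le> \<bar>l\<bar> * \<bar>W t\<bar> + \<bar>Q t\<bar>"
      by (metis abs_mult abs_triangle_ineq4)
    also have "\<dots> \<le> (\<bar>c\<bar> + \<bar>d\<bar>) * CW + CQ"
      using l CW(2)[OF t] CQ(2)[OF t] by (intro add_mono mult_mono) auto
    finally have "\<bar>A t\<bar> + \<bar>l * W t - Q t\<bar> \<le> L"
      using CA(2)[OF t] by (simp add: L_def)
    then have "(\<bar>A t\<bar> + \<bar>l * W t - Q t\<bar>) * \<bar>y - z\<bar> \<le> L * \<bar>y - z\<bar>"
      by (intro mult_right_mono) auto
    with pruefer_rhs_lipschitz[of "A t" y "l * W t - Q t" z] show ?thesis
      unfolding f_def by linarith
  qed
  have "\<exists>\<theta>. continuous_on {a..b} \<theta> \<and> (\<forall>x\<in>{a..b}. \<theta> x = integral {a..x} (\<lambda>t. f l t (\<theta> t)))"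
    if "l \<in> {c..d}" for l
  proof (rule volterra_solution_exists[where f = "f l", OF \<open>a \<le> b\<close> \<open>L > 0\<close>])
    show "continuous_on {a..b} (\<lambda>t. f l t (\<phi> t))" if "continuous_on {a..b} \<phi>" for \<phi>
      using that by (rule f_cont)
    show "\<bar>f l t y - f l t z\<bar> \<le> L * \<bar>y - z\<bar>" if "t \<in> {a..b}" for t y z
      using \<open>l \<in> {c..d}\<close> that by (rule f_lip)
  qed blast
  then obtain \<theta> where \<theta>: "\<And>l. l \<in> {c..d} \<Longrightarrow> continuous_on {a..b} (\<theta> l)"
    and \<theta>_int: "\<And>l x. l \<in> {c..d} \<Longrightarrow> x \<in> {a..b} \<Longrightarrow> \<theta> l x = integral {a..x} (\<lambda>t. f l t (\<theta> l t))"
    by metis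
  show ?thesis
  proof (rule that[of \<theta>])
    fix l assume l: "l \<in> {c..d}"
    show "\<theta> l a = 0" using \<theta>_int[OF l, of a] \<open>a \<le> b\<close> by simp
    fix x assume x: "x \<in> {a..b}"
    show "(\<theta> l has_real_derivative
        A x * (cos (\<theta> l x))\<^sup>2 + (l * W x - Q x) * (sin (\<theta> l x))\<^sup>2) (at x within {a..b})"
      using integral_has_real_derivative[OF f_cont[OF \<theta>[OF l], of l] x] zero_less_one x
      unfolding f_def by (rule has_field_derivative_transform_within) (simp add: \<theta>_int[OF l] f_def)
  next
    \<comment> \<open>The right-hand sides for the parameters \<open>l\<close> and \<open>m\<close> differ by at most \<open>CW * \<bar>l - m\<bar>\<close>, which acts
      as the perturbation in Gronwall's inequality.\<close>
    have "\<bar>\<theta> l b - \<theta> m b\<bar> \<le> (CW / L * exp (2 * L * (b - a))) * \<bar>l - m\<bar>"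
      if l: "l \<in> {c..d}" and m: "m \<in> {c..d}" for l m
    proof -
      let ?g = "\<lambda>t. f l t (\<theta> l t) - f m t (\<theta> m t)"
      have "\<bar>\<theta> l b - \<theta> m b\<bar> \<le> (CW * \<bar>l - m\<bar>) / L * exp (2 * L * (b - a))"
      proof (rule volterra_growth_bound[where d = "\<lambda>x. \<theta> l x - \<theta> m x" and g = ?g])
        show "\<theta> l x - \<theta> m x = integral {a..x} ?g" if x: "x \<in> {a..b}" for x
          using x \<theta>_int[OF l x] \<theta>_int[OF m x]
          by (subst integral_diff)
             (auto intro!: integrable_continuous_real continuous_on_subset[OF f_cont] \<theta> l m)
        fix t assume t: "t \<in> {a..b}"
        have "f l t (\<theta> m t) - f m t (\<theta> m t) = W t * (l - m) * (sin (\<theta> m t))\<^sup>2"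
          by (simp add: f_def algebra_simps)
        also have "\<bar>\<dots>\<bar> \<le> CW * \<bar>l - m\<bar> * 1"
          unfolding abs_mult using CW t
          by (intro mult_mono) (auto simp: abs_square_le_1)
        finally show "\<bar>?g t\<bar> \<le> L * \<bar>\<theta> l t - \<theta> m t\<bar> + CW * \<bar>l - m\<bar>"
          using f_lip[OF l t, of "\<theta> l t" "\<theta> m t"] by linarith
      qed (use \<open>a \<le> b\<close> \<open>L > 0\<close> CW in \<open>auto intro!: continuous_on_diff f_cont \<theta> l m\<close>)
      then show ?thesis by (simp add: field_simps)
    qed
    then have "(CW / L * exp (2 * L * (b - a)))-lipschitz_on {c..d} (\<lambda>l. \<theta> l b)"
      using CW \<open>L > 0\<close> by (intro lipschitz_onI) (auto simp: dist_real_def)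
    then show "continuous_on {c..d} (\<lambda>l. \<theta> l b)"
      by (rule lipschitz_on_continuous_on)
  qed
qed

text \<open>
  The linear system \<open>u' = A w\<close>, \<open>w' = - B u\<close> is equivalent in polar coordinates to the angle equation
  together with \<open>r' / r = (A - B) sin \<theta> cos \<theta>\<close>. The latter is solved by an integral once
  the angle is known, so the nonlinear scalar equation yields a solution of the linear system.
\<close>

lemma pruefer_amplitude:
  fixes A B \<theta> :: "real \<Rightarrow> real"
  assumes A: "continuous_on {a..b} A" and B: "continuous_on {a..b} B"
    and \<theta>: "\<And>x. x \<in> {a..b} \<Longrightarrow> (\<theta> has_real_derivative
        A x * (cos (\<theta> x))\<^sup>2 + B x * (sin (\<theta> x))\<^sup>2) (at x within {a..b})"
  obtains r where "\<And>x. r x > 0"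
    and "\<And>x. x \<in> {a..b} \<Longrightarrow> ((\<lambda>t. r t * sin (\<theta> t)) has_real_derivative
        A x * (r x * cos (\<theta> x))) (at x within {a..b})"
    and "\<And>x. x \<in> {a..b} \<Longrightarrow> ((\<lambda>t. r t * cos (\<theta> t)) has_real_derivative
        - B x * (r x * sin (\<theta> x))) (at x within {a..b})"
proof -
  let ?g = "\<lambda>t. (A t - B t) * (sin (\<theta> t) * cos (\<theta> t))"
  define r where "r x = exp (integral {a..x} ?g)" for x
  have "continuous_on {a..b} \<theta>"
    using \<theta> by (rule DERIV_continuous_on)
  then have "continuous_on {a..b} ?g"
    using A B by (intro continuous_intros)
  then have r: "(r has_real_derivative r x * ?g x) (at x within {a..b})" if "x \<in> {a..b}" for x
    unfolding r_def using that by (auto intro!: derivative_eq_intros integral_has_real_derivative)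
  show ?thesis
  proof (rule that[of r])
    show "r x > 0" for x by (simp add: r_def)
    fix x assume x: "x \<in> {a..b}"
    have sc: "(sin (\<theta> x))\<^sup>2 = 1 - (cos (\<theta> x))\<^sup>2"
      by (simp add: sin_squared_eq)
    show "((\<lambda>t. r t * sin (\<theta> t)) has_real_derivative A x * (r x * cos (\<theta> x))) (at x within {a..b})"
      apply (rule derivative_eq_intros r[OF x] \<theta>[OF x] refl)+
      using sc by algebra
    show "((\<lambda>t. r t * cos (\<theta> t)) has_real_derivative - B x * (r x * sin (\<theta> x))) (at x within {a..b})"
      apply (rule derivative_eq_intros r[OF x] \<theta>[OF x] refl)+
      using sc by algebra
  qed
qed

text \<open>
  At a first point where \<open>\<theta>\<close> equals \<open>c\<close>, a negative derivative would force \<open>\<theta> > c\<close> slightly to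
  the left, and hence an earlier such point.
\<close>

lemma below_barrier:
  fixes \<theta> :: "real \<Rightarrow> real"
  assumes "a \<le> b" "continuous_on {a..b} \<theta>" "\<theta> a < c"
    and dec: "\<And>x. x \<in> {a..b} \<Longrightarrow> \<theta> x = c \<Longrightarrow>
      \<exists>d<0. (\<theta> has_real_derivative d) (at x within {a..b})"
  shows "\<theta> b < c"
proof (rule ccontr)
  assume "\<not> \<theta> b < c"
  define S where "S = {x \<in> {a..b}. \<theta> x = c}"
  have hit: "\<exists>x\<in>S. x \<le> y" if "y \<in> {a..b}" "c \<le> \<theta> y" for y
  proof -
    have "continuous_on {a..y} \<theta>"
      using assms(2) by (rule continuous_on_subset) (use that in auto)
    then show ?thesis
      using IVT'[of \<theta> a c y] that assms(3) by (auto simp: S_def)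
  qed
  have S_compact: "compact S"
    unfolding S_def compact_eq_bounded_closed
  proof
    show "bounded {x \<in> {a..b}. \<theta> x = c}"
      by (rule bounded_subset[of "{a..b}"]) auto
    show "closed {x \<in> {a..b}. \<theta> x = c}"
      using continuous_closed_preimage_constant[OF assms(2)] by simp
  qed
  have S_nonempty: "S \<noteq> {}"
    using hit[of b] \<open>a \<le> b\<close> \<open>\<not> \<theta> b < c\<close> by auto
  obtain x where x: "x \<in> S" and first: "\<And>y. y \<in> S \<Longrightarrow> x \<le> y"
    using compact_attains_inf[OF S_compact S_nonempty] by blast
  have xab: "x \<in> {a..b}" "\<theta> x = c" using x by (auto simp: S_def)
  have "a < x" using xab \<open>\<theta> a < c\<close> by (cases "a = x") auto
  obtain e where "e > 0" and e: "\<And>h. h > 0 \<Longrightarrow> x - h \<in> {a..b} \<Longrightarrow> h < e \<Longrightarrow> \<theta> x < \<theta> (x - h)"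
    using dec[OF xab] has_real_derivative_neg_dec_left by metis
  define h where "h = min (e / 2) (x - a)"
  have h: "h > 0" "h < e" "x - h \<in> {a..b}"
    using \<open>e > 0\<close> \<open>a < x\<close> xab by (auto simp: h_def)
  with e[of h] hit[of "x - h"] first xab show False by fastforce
qed

section \<open>From the Pruefer angle to eigenvalues\<close>

text \<open>
  The eigenfunction is \<open>y = r sin \<theta> exp (- s_bar)\<close>, with quasi-derivative \<open>z = k r cos \<theta> exp (s_bar)\<close>.
  It vanishes exactly where \<open>\<theta>\<close> is a multiple of \<open>\<pi>\<close>. The requirement \<open>j \<ge> 1\<close> makes the angle
  pass through \<open>\<pi> / 2\<close>, so that \<open>y\<close> is not identically zero.
\<close>

lemma eigenvalue_if_pruefer_angle_multiple_of_pi: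
  fixes k :: real and j :: nat
  assumes "a < b"
    and p: "continuous_on {a..b} p" and s: "continuous_on {a..b} s"
    and q: "continuous_on {a..b} q" and \<omega>: "continuous_on {a..b} \<omega>"
    and p_pos: "\<And>x. x \<in> {a..b} \<Longrightarrow> p x > 0" and "k > 0"
    and \<theta>: "\<And>x. x \<in> {a..b} \<Longrightarrow> (\<theta> has_real_derivative
        (k / exp_weight a s p x) * (cos (\<theta> x))\<^sup>2
        + ((\<mu> * exp_weight a s \<omega> x - exp_weight a s q x) / k) * (sin (\<theta> x))\<^sup>2) (at x within {a..b})"
    and "\<theta> a = 0" "\<theta> b = real j * pi" "j \<ge> 1"
  shows "SL_eigenvalue a b p s q \<omega> \<mu>"
proof -
  let ?S = "s_bar a s"
  have S: "(?S has_real_derivative s x) (at x within {a..b})" if "x \<in> {a..b}" for x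
    unfolding s_bar_def[abs_def] using s that by (rule integral_has_real_derivative)
  have S_cont: "continuous_on {a..b} ?S"
    using S by (rule DERIV_continuous_on)
  have ew: "continuous_on {a..b} (exp_weight a s g)" if "continuous_on {a..b} g" for g
    unfolding exp_weight_def[abs_def] using that S_cont by (intro continuous_intros)
  have A: "continuous_on {a..b} (\<lambda>x. k / exp_weight a s p x)"
    using p_pos by (intro continuous_intros ew p) (force simp: exp_weight_def)
  have B: "continuous_on {a..b} (\<lambda>x. (\<mu> * exp_weight a s \<omega> x - exp_weight a s q x) / k)"
    using \<open>k > 0\<close> by (intro continuous_intros ew \<omega> q) auto
  obtain r where r: "\<And>x. r x > 0"
    and u: "\<And>x. x \<in> {a..b} \<Longrightarrow> ((\<lambda>t. r t * sin (\<theta> t)) has_real_derivative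
        k / exp_weight a s p x * (r x * cos (\<theta> x))) (at x within {a..b})"
    and w: "\<And>x. x \<in> {a..b} \<Longrightarrow> ((\<lambda>t. r t * cos (\<theta> t)) has_real_derivative
        - ((\<mu> * exp_weight a s \<omega> x - exp_weight a s q x) / k) * (r x * sin (\<theta> x))) (at x within {a..b})"
    using pruefer_amplitude[OF A B \<theta>] by blast
  define U where "U x = r x * sin (\<theta> x)" for x
  define V where "V x = r x * cos (\<theta> x)" for x
  note u = u[folded U_def V_def] and w = w[folded U_def V_def]
  define y where "y x = U x * exp (- ?S x)" for x
  define z where "z x = k * V x * exp (?S x)" for x
  \<comment> \<open>\<open>y'\<close> and \<open>z'\<close> are read off from the differential equation, written as a first-order system
    for \<open>y\<close> and \<open>z\<close>.\<close>
  define y' where "y' x = z x / p x - s x * y x" for x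
  define z' where "z' x = (q x - \<mu> * \<omega> x) * y x + s x * z x" for x
  have e2: "exp (2 * ?S x) = exp (?S x) * exp (?S x)" for x
    by (simp flip: exp_add)
  have y: "(y has_real_derivative y' x) (at x within {a..b})" if x: "x \<in> {a..b}" for x
    unfolding y_def[abs_def]
    apply (rule derivative_eq_intros u[OF x] S[OF x] refl)+
    using p_pos[OF x]
    by (simp add: y'_def y_def z_def exp_weight_def e2 exp_minus field_simps)
  have z: "(z has_real_derivative z' x) (at x within {a..b})" if x: "x \<in> {a..b}" for x
    unfolding z_def[abs_def]
    apply (rule derivative_eq_intros w[OF x] S[OF x] refl)+
    using \<open>k > 0\<close>
    by (simp add: z'_def y_def z_def exp_weight_def e2 exp_minus field_simps)
  have quasi: "p t * (y' t + s t * y t) = z t" if "t \<in> {a..b}" for t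
    using p_pos[OF that] by (simp add: y'_def)
  have "SL_solution a b p s q \<omega> \<mu> y"
    unfolding SL_solution_def
  proof (intro exI ballI conjI)
    fix x assume x: "x \<in> {a..b}"
    show "(y has_real_derivative y' x) (at x within {a..b})" using y[OF x] .
    show "((\<lambda>t. p t * (y' t + s t * y t)) has_real_derivative z' x) (at x within {a..b})"
      using z[OF x] zero_less_one x
      by (rule has_field_derivative_transform_within) (simp add: quasi)
    show "- z' x + s x * p x * (y' x + s x * y x) + q x * y x = \<mu> * \<omega> x * y x"
      unfolding mult.assoc[of "s x"] quasi[OF x] by (simp add: z'_def algebra_simps)
  qed
  moreover have "y a = 0" "y b = 0"
    using assms by (auto simp: y_def U_def)
  moreover have "\<exists>x\<in>{a..b}. y x \<noteq> 0"
  proof -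
    have "pi / 2 \<le> \<theta> b"
      using mult_mono[of 1 "real j" "pi/2" pi] assms by simp
    then obtain x where x: "x \<in> {a..b}" "\<theta> x = pi / 2"
      using IVT'[of \<theta> a "pi/2" b] assms DERIV_continuous_on[OF \<theta>] by auto
    have "y x \<noteq> 0"
      unfolding y_def U_def x(2) using r[of x] by simp
    with x(1) show ?thesis by blast
  qed
  ultimately show ?thesis unfolding SL_eigenvalue_def by blast
qed

section \<open>Counting the eigenvalues below the bound\<close>

text \<open>
  As the listing is increasing, \<open>ev n > \<Lambda>\<close> would leave only \<open>ev 1, \<dots>, ev (n - 1)\<close> as eigenvalues
  that are at most \<open>\<Lambda>\<close>.
\<close>

lemma listing_le_if_enough_eigenvalues:
  assumes ev: "SL_eigenvalue_listing a b p s q \<omega> ev"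
    and "finite E" "card E \<ge> n" "n \<ge> 1"
    and E: "\<And>\<mu>. \<mu> \<in> E \<Longrightarrow> SL_eigenvalue a b p s q \<omega> \<mu> \<and> \<mu> \<le> \<Lambda>"
  shows "ev n \<le> \<Lambda>"
proof (rule ccontr)
  assume "\<not> ev n \<le> \<Lambda>"
  have "E \<subseteq> ev ` {1..<n}"
  proof
    fix \<mu> assume "\<mu> \<in> E"
    with E ev obtain i where i: "i \<ge> 1" "\<mu> = ev i" "ev i \<le> \<Lambda>"
      unfolding SL_eigenvalue_listing_def by force
    have "i < n"
    proof (rule ccontr)
      assume "\<not> i < n"
      then have "ev n \<le> ev i"
        using ev \<open>n \<ge> 1\<close> unfolding SL_eigenvalue_listing_def strict_mono_on_def
        by (cases "i = n") (auto simp: less_imp_le)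
      with i \<open>\<not> ev n \<le> \<Lambda>\<close> show False by simp
    qed
    with i show "\<mu> \<in> ev ` {1..<n}" by auto
  qed
  then have "card E \<le> card {1..<n}"
    by (meson card_image_le card_mono finite_atLeastLessThan finite_imageI le_trans)
  with assms show False by simp
qed

theorem theorem3p5:
  fixes a b D M :: real
    and p s q \<omega> h :: "real \<Rightarrow> real"
    and ev :: "nat \<Rightarrow> real"
  assumes "a < b"
    and "continuous_on {a..b} p" and "continuous_on {a..b} s"
    and "continuous_on {a..b} q" and "continuous_on {a..b} \<omega>"
    and "\<And>x. x \<in> {a..b} \<Longrightarrow> p x > 0"
    and "\<And>x. x \<in> {a..b} \<Longrightarrow> \<omega> x > 0"
    and "SL_eigenvalue_listing a b p s q \<omega> ev"
    and "continuous_on {a..b} h"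
    and "\<And>x. x \<in> {a..b} \<Longrightarrow> h x \<ge> exp_weight a s p x"
    and "D = (INF x\<in>{a..b}. exp_weight a s \<omega> x * h x)"
    and "M = (SUP x\<in>{a..b}. q x / \<omega> x)"
  shows "D > 0 \<and>
    (\<forall>n\<ge>1. ev n \<le> (real n)\<^sup>2 * pi\<^sup>2 / (D * (integral {a..b} (\<lambda>x. 1 / h x))\<^sup>2) + M)"
proof -
  note p_pos = assms(6) and \<omega>_pos = assms(7)
  have S_cont: "continuous_on {a..b} (s_bar a s)"
    unfolding s_bar_def[abs_def]
    by (intro indefinite_integral_continuous_1 integrable_continuous_real assms)
  have ew: "continuous_on {a..b} (exp_weight a s g)" if "continuous_on {a..b} g" for g
    unfolding exp_weight_def[abs_def] using that S_cont by (intro continuous_intros)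
  have pt_pos: "exp_weight a s p x > 0" and \<omega>t_pos: "exp_weight a s \<omega> x > 0" if "x \<in> {a..b}" for x
    using p_pos[OF that] \<omega>_pos[OF that] by (auto simp: exp_weight_def)
  have h_pos: "h x > 0" if "x \<in> {a..b}" for x
    using pt_pos[OF that] assms(10)[OF that] by linarith
  have ne: "{a..b} \<noteq> {}" using \<open>a < b\<close> by simp
  have "continuous_on {a..b} (\<lambda>x. exp_weight a s \<omega> x * h x)"
    by (intro continuous_intros ew assms)
  then obtain x0 where x0: "x0 \<in> {a..b}"
    and x0_min: "\<And>x. x \<in> {a..b} \<Longrightarrow> exp_weight a s \<omega> x0 * h x0 \<le> exp_weight a s \<omega> x * h x"
    using continuous_attains_inf[OF compact_Icc ne] by blast
  have D_eq: "D = exp_weight a s \<omega> x0 * h x0"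
    unfolding assms(11) using x0 x0_min by (intro cInf_eq_minimum) auto
  have "D > 0"
    unfolding D_eq using \<omega>t_pos[OF x0] h_pos[OF x0] by simp
  have D_le: "D \<le> exp_weight a s \<omega> x * h x" if "x \<in> {a..b}" for x
    using x0_min[OF that] by (simp add: D_eq)
  have qw: "continuous_on {a..b} (\<lambda>x. q x / \<omega> x)"
    using \<omega>_pos by (intro continuous_intros assms) force
  have "bdd_above ((\<lambda>x. q x / \<omega> x) ` {a..b})"
    by (intro bounded_imp_bdd_above compact_imp_bounded compact_continuous_image qw compact_Icc)
  then have M_ge: "q x / \<omega> x \<le> M" if "x \<in> {a..b}" for x
    unfolding assms(12) using that by (rule cSUP_upper[rotated])
  obtain x1 where x1: "x1 \<in> {a..b}" and x1_min: "\<And>x. x \<in> {a..b} \<Longrightarrow> q x1 / \<omega> x1 \<le> q x / \<omega> x"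
    using continuous_attains_inf[OF compact_Icc ne qw] by blast
  \<comment> \<open>Subtracting \<open>1\<close> makes the derivative at the barrier \<open>\<pi> / 2\<close> strictly negative.\<close>
  define \<mu>0 where "\<mu>0 = q x1 / \<omega> x1 - 1"
  define H where "H = integral {a..b} (\<lambda>x. 1 / h x)"
  have ih_cont: "continuous_on {a..b} (\<lambda>x. 1 / h x)"
    using h_pos assms(9) by (intro continuous_intros) force+
  have ih: "((\<lambda>x. 1 / h x) has_integral H) {a..b}"
    unfolding H_def by (intro integrable_integral integrable_continuous_real ih_cont)
  have "H > 0"
  proof -
    have "H \<ge> 0"
      using ih by (rule has_integral_nonneg) (use h_pos in \<open>auto intro: less_imp_le\<close>)
    moreover have "H \<noteq> 0"
    proof
      assume "H = 0"
      then have "\<forall>x\<in>{a..b}. 1 / h x = 0"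
        using integral_eq_0_iff[OF ih_cont \<open>a < b\<close>] h_pos by (auto simp: H_def less_imp_le)
      with x0 h_pos show False by fastforce
    qed
    ultimately show ?thesis by simp
  qed
  have "ev n \<le> (real n)\<^sup>2 * pi\<^sup>2 / (D * H\<^sup>2) + M" if "n \<ge> 1" for n
  proof -
    define k where "k = real n * pi / H"
    define \<Lambda> where "\<Lambda> = k\<^sup>2 / D + M"
    have "k > 0" using \<open>n \<ge> 1\<close> \<open>H > 0\<close> by (simp add: k_def)
    \<comment> \<open>The interval from \<open>\<mu>0\<close> to \<open>\<Lambda>\<close> is where the intermediate value theorem finds the eigenvalues.\<close>
    have "\<mu>0 \<le> \<Lambda>"
    proof -
      have "\<mu>0 \<le> M" using M_ge[OF x1] by (simp add: \<mu>0_def)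
      then show ?thesis using \<open>D > 0\<close> by (simp add: \<Lambda>_def add_increasing)
    qed
    let ?A = "\<lambda>x. k / exp_weight a s p x"
    let ?B = "\<lambda>l x. l * (exp_weight a s \<omega> x / k) - exp_weight a s q x / k"
    have cA: "continuous_on {a..b} ?A"
      using pt_pos by (intro continuous_intros ew assms) force
    have cW: "continuous_on {a..b} (\<lambda>x. exp_weight a s g x / k)" if "continuous_on {a..b} g" for g
      using that \<open>k > 0\<close> by (intro continuous_intros ew) auto
    obtain \<theta> where \<theta>0: "\<And>l. l \<in> {\<mu>0..\<Lambda>} \<Longrightarrow> \<theta> l a = 0"
      and \<theta>: "\<And>l x. l \<in> {\<mu>0..\<Lambda>} \<Longrightarrow> x \<in> {a..b} \<Longrightarrow> (\<theta> l has_real_derivative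
           ?A x * (cos (\<theta> l x))\<^sup>2 + ?B l x * (sin (\<theta> l x))\<^sup>2) (at x within {a..b})"
      and \<theta>b: "continuous_on {\<mu>0..\<Lambda>} (\<lambda>l. \<theta> l b)"
      using pruefer_angle_family[OF less_imp_le[OF \<open>a < b\<close>] cA cW[OF assms(5)] cW[OF assms(4)],
          of \<mu>0 \<Lambda>] by blast
    have \<mu>0: "\<mu>0 \<in> {\<mu>0..\<Lambda>}" and \<Lambda>: "\<Lambda> \<in> {\<mu>0..\<Lambda>}" using \<open>\<mu>0 \<le> \<Lambda>\<close> by auto
    have "\<theta> \<mu>0 b < pi / 2"
    proof (rule below_barrier[where a = a and \<theta> = "\<theta> \<mu>0"])
      show "continuous_on {a..b} (\<theta> \<mu>0)" using \<theta>[OF \<mu>0] by (rule DERIV_continuous_on)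
      fix x assume x: "x \<in> {a..b}" and "\<theta> \<mu>0 x = pi / 2"
      then have "cos (\<theta> \<mu>0 x) = 0" "sin (\<theta> \<mu>0 x) = 1"
        by (simp_all only: cos_pi_half sin_pi_half)
      then have "(\<theta> \<mu>0 has_real_derivative ?B \<mu>0 x) (at x within {a..b})"
        using \<theta>[OF \<mu>0 x] by simp
      moreover have "?B \<mu>0 x < 0"
      proof -
        have "\<mu>0 < q x / \<omega> x" using x1_min[OF x] by (simp add: \<mu>0_def)
        then have "\<mu>0 * \<omega> x < q x" using \<omega>_pos[OF x] by (simp add: pos_less_divide_eq)
        then have "\<mu>0 * exp_weight a s \<omega> x < exp_weight a s q x"
          by (simp add: exp_weight_def flip: mult.assoc)
        then show ?thesis using \<open>k > 0\<close> by (simp add: divide_strict_right_mono)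
      qed
      ultimately show "\<exists>d<0. (\<theta> \<mu>0 has_real_derivative d) (at x within {a..b})" by blast
    qed (use \<open>a < b\<close> \<theta>0[OF \<mu>0] in auto)
    have "real n * pi \<le> \<theta> \<Lambda> b"
    proof -
      let ?f = "\<lambda>x. ?A x * (cos (\<theta> \<Lambda> x))\<^sup>2 + ?B \<Lambda> x * (sin (\<theta> \<Lambda> x))\<^sup>2"
      have f_int: "(?f has_integral \<theta> \<Lambda> b - \<theta> \<Lambda> a) {a..b}"
        using \<open>a < b\<close> \<theta>[OF \<Lambda>]
        by (intro fundamental_theorem_of_calculus)
           (auto simp flip: has_real_derivative_iff_has_vector_derivative)
      have lower_int: "((\<lambda>x. k * (1 / h x)) has_integral k * H) {a..b}"
        using ih by (rule has_integral_mult_right)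
      have lower: "k * (1 / h x) \<le> ?f x" if x: "x \<in> {a..b}" for x
      proof -
        have A: "k / h x \<le> ?A x"
          using pt_pos[OF x] assms(10)[OF x] \<open>k > 0\<close> by (intro divide_left_mono) auto
        have "k * k / h x = k\<^sup>2 / D * (D / h x)"
          using \<open>D > 0\<close> by (simp add: power2_eq_square)
        also have "\<dots> \<le> k\<^sup>2 / D * exp_weight a s \<omega> x"
          using D_le[OF x] h_pos[OF x] \<open>D > 0\<close>
          by (intro mult_left_mono) (auto simp: pos_divide_le_eq)
        also have "\<dots> \<le> (\<Lambda> - q x / \<omega> x) * exp_weight a s \<omega> x"
          using M_ge[OF x] \<omega>t_pos[OF x] by (intro mult_right_mono) (auto simp: \<Lambda>_def)
        also have "\<dots> = \<Lambda> * exp_weight a s \<omega> x - exp_weight a s q x"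
          using \<omega>_pos[OF x] by (simp add: exp_weight_def field_simps)
        also have "\<dots> = k * ?B \<Lambda> x"
          using \<open>k > 0\<close> by (simp add: field_simps)
        finally have B: "k / h x \<le> ?B \<Lambda> x"
          using \<open>k > 0\<close> by (simp flip: times_divide_eq_right)
        have "k * (1 / h x) = k / h x * (cos (\<theta> \<Lambda> x))\<^sup>2 + k / h x * (sin (\<theta> \<Lambda> x))\<^sup>2"
          unfolding distrib_left[symmetric] sin_cos_squared_add2 by simp
        also have "\<dots> \<le> ?f x"
          using A B by (intro add_mono mult_right_mono) auto
        finally show ?thesis .
      qed
      have "k * H \<le> \<theta> \<Lambda> b - \<theta> \<Lambda> a"
        using lower_int f_int lower by (rule has_integral_le)
      then show ?thesis using \<theta>0[OF \<Lambda>] \<open>H > 0\<close> by (simp add: k_def)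
    qed
    have "\<exists>l\<in>{\<mu>0..\<Lambda>}. \<theta> l b = real j * pi" if j: "j \<in> {1..n}" for j
    proof -
      have "pi \<le> real j * pi" "real j * pi \<le> real n * pi" using j by auto
      then have le: "\<theta> \<mu>0 b \<le> real j * pi" "real j * pi \<le> \<theta> \<Lambda> b"
        using \<open>\<theta> \<mu>0 b < pi / 2\<close> \<open>real n * pi \<le> \<theta> \<Lambda> b\<close> pi_gt_zero by linarith+
      show ?thesis
        using IVT'[of "\<lambda>l. \<theta> l b", OF le \<open>\<mu>0 \<le> \<Lambda>\<close> \<theta>b] by auto
    qed
    then obtain l where l: "\<And>j. j \<in> {1..n} \<Longrightarrow> l j \<in> {\<mu>0..\<Lambda>}"
      and lb: "\<And>j. j \<in> {1..n} \<Longrightarrow> \<theta> (l j) b = real j * pi"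
      by metis
    have "inj_on l {1..n}"
    proof (rule inj_onI)
      fix i j assume "i \<in> {1..n}" "j \<in> {1..n}" "l i = l j"
      then have "real i * pi = real j * pi" using lb by metis
      then show "i = j" by simp
    qed
    have "SL_eigenvalue a b p s q \<omega> (l j)" if j: "j \<in> {1..n}" for j
    proof (rule eigenvalue_if_pruefer_angle_multiple_of_pi[where \<theta> = "\<theta> (l j)" and k = k and j = j])
      fix x assume "x \<in> {a..b}"
      then show "(\<theta> (l j) has_real_derivative k / exp_weight a s p x * (cos (\<theta> (l j) x))\<^sup>2
          + (l j * exp_weight a s \<omega> x - exp_weight a s q x) / k * (sin (\<theta> (l j) x))\<^sup>2)
          (at x within {a..b})"
        using \<theta>[OF l[OF j]] by (simp add: diff_divide_distrib)
    qed (use assms j lb \<theta>0[OF l[OF j]] \<open>k > 0\<close> in auto)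
    then have "ev n \<le> \<Lambda>"
      using l \<open>inj_on l {1..n}\<close> \<open>n \<ge> 1\<close>
      by (intro listing_le_if_enough_eigenvalues[OF assms(8), of "l ` {1..n}"])
         (auto simp: card_image)
    then show ?thesis
      by (simp add: \<Lambda>_def k_def power_divide power_mult_distrib mult.commute)
  qed
  then show ?thesis using \<open>D > 0\<close> by (simp add: H_def)
qed

end
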